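(* Let $\Lambda=\{\lambda_j\}_{j\ge1}$ be a Waterman sequence, let $1<q\le\infty$, let $\{q_n\}_{n\ge1}$ be a sequence of real numbers with $1\le q_n\uparrow q$, and let $\{\delta_n\}_{n\ge1}$ be a sequence of real numbers with $2\le\delta_n\uparrow\infty$. Then $$\bigcup_{1\le p<q}\Lambda\mathrm{BV}^{(p)}\subseteq\Lambda\mathrm{BV}^{(q_n\uparrow q)} .$$
   Context: A Waterman sequence is a nondecreasing sequence $\Lambda=\{\lambda_j\}_{j=1}^\infty$ of positive numbers with $\sum_{j=1}^\infty 1/\lambda_j=\infty$. The notation $q_n\uparrow q$ means that $\{q_n\}$ is nondecreasing (possibly constant) with limit $q$; $\delta_n\uparrow\infty$ means nondecreasing with limit $\infty$. All functions are real-valued on $[0,1]$. For an interval $I\subseteq[0,1]$, $f(I):=f(\sup I)-f(\inf I)$ and $|I|$ is its length. For $1\le p<\infty$, $\Lambda\mathrm{BV}^{(p)}$ (the Waterman-Shiba class) is the set of all $f$ such that $\sup\sum_{j=1}^s |f(I_j)|^p/\lambda_j<\infty$, the supremum being over all finite (ordered) collections $\{I_j\}_{j=1}^s$ of nonoverlapping subintervals of $[0,1]$. $\Lambda\mathrm{BV}^{(q_n\uparrow q)}$ $(=\Lambda\mathrm{BV}_\delta^{(q_n\uparrow q)})$ is the set of all $f$ such that $$\sup_{n\ge1}\ \sup_{\{I_j\}}\Big(\sum_{j=1}^s\frac{|f(I_j)|^{q_n}}{\lambda_j}\Big)^{1/q_n}<\infty,$$ where, for each $n$, the inner supremum is over all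 finite collections $\{I_j\}_{j=1}^s$ of nonoverlapping subintervals of $[0,1]$ with $\inf_j|I_j|\ge 1/\delta_n$. *)

theory Defs
  imports "HOL-Analysis.Analysis"
begin

text \<open>
  All sequences \<open>x\<^sub>1, x\<^sub>2, \<dots>\<close> and families \<open>I\<^sub>1, \<dots>, I\<^sub>s\<close> are indexed from \<open>0\<close>:
  \<open>x n\<close> stands for the term with index \<open>n + 1\<close>, and \<open>j < s\<close> for \<open>1 \<le> j \<le> s\<close>.
\<close>

definition waterman :: "(nat \<Rightarrow> real) \<Rightarrow> bool" where
  "waterman \<Lambda> \<longleftrightarrow>
     (\<forall>j. 0 < \<Lambda> j) \<and> incseq \<Lambda> \<and> filterlim (\<lambda>n. \<Sum>j<n. 1 / \<Lambda> j) at_top sequentially"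

definition increment :: "(real \<Rightarrow> real) \<Rightarrow> real set \<Rightarrow> real" where
  "increment f I = f (Sup I) - f (Inf I)"

definition len :: "real set \<Rightarrow> real" where
  "len I = Sup I - Inf I"

text \<open>
  Intervals may be open, closed or half-open; nonoverlapping means that the interiors are
  disjoint. One-point intervals are allowed: they have increment \<open>0\<close>, hence contribute
  nothing to the sums below.
\<close>

definition nonoverlapping :: "nat \<Rightarrow> (nat \<Rightarrow> real set) \<Rightarrow> bool" where
  "nonoverlapping s I \<longleftrightarrow>
     (\<forall>j<s. is_interval (I j) \<and> I j \<noteq> {} \<and> I j \<subseteq> {0..1}) \<and>
     disjoint_family_on (\<lambda>j. interior (I j)) {..<s}"

definition variation_sum :: "(nat \<Rightarrow> real) \<Rightarrow> real \<Rightarrow> (real \<Rightarrow> real) \<Rightarrow> nat \<Rightarrow> (nat \<Rightarrow> real set) \<Rightarrow> real"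
  where "variation_sum \<Lambda> p f s I = (\<Sum>j<s. \<bar>increment f (I j)\<bar> powr p / \<Lambda> j)"

text \<open>
  A function on \<open>[0,1]\<close> is represented by a total function on the reals; membership in the
  classes below depends only on its values on \<open>[0,1]\<close>. Suprema are taken in the extended
  reals, so that being finite is a genuine condition.
\<close>

definition waterman_shiba :: "(nat \<Rightarrow> real) \<Rightarrow> real \<Rightarrow> (real \<Rightarrow> real) set" where
  "waterman_shiba \<Lambda> p =
     {f. (SUP (s, I) \<in> {(s, I). nonoverlapping s I}. ereal (variation_sum \<Lambda> p f s I)) < \<infinity>}"

definition LBV_seq :: "(nat \<Rightarrow> real) \<Rightarrow> (nat \<Rightarrow> real) \<Rightarrow> (nat \<Rightarrow> real) \<Rightarrow> (real \<Rightarrow> real) set" where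
  "LBV_seq \<Lambda> \<delta> q =
     {f. (SUP n. SUP (s, I) \<in> {(s, I). nonoverlapping s I \<and> (\<forall>j<s. len (I j) \<ge> 1 / \<delta> n)}.
            ereal (variation_sum \<Lambda> (q n) f s I powr (1 / q n))) < \<infinity>}"

end

theory Submission
  imports Defs
begin

text \<open>
  Let \<open>f\<close> have bounded \<open>p\<close>-variation sums, \<open>p < Q\<close>. Testing with a single interval shows that
  all increments of \<open>f\<close> are at most some \<open>B \<ge> 1\<close>. The exponents \<open>q n\<close> are eventually at
  least \<open>p\<close>, say from \<open>N\<close> on, and indices with \<open>q n \<ge> p\<close> and with \<open>q n < p\<close> are
  controlled for different reasons.

  If \<open>q n \<ge> p\<close>, the bound on the increments lets the exponent be raised:
  \<open>x powr q n \<le> B powr q n * x powr p\<close> for \<open>0 \<le> x \<le> B\<close>. The factor \<open>B powr q n\<close> may be unbounded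
  in \<open>n\<close>, but it becomes the constant \<open>B\<close> once the \<open>q n\<close>-th root is taken
  (lemmas \<open>increment_le\<close> and \<open>variation_sum_raise_exponent\<close>).

  If \<open>q n < p\<close>, the exponent has to be lowered, which costs a constant for each interval:
  \<open>x powr q n \<le> 1 + x powr p\<close>. This is affordable because nonoverlapping intervals of length
  at least \<open>1 / \<delta> n\<close> in \<open>[0,1]\<close> number at most \<open>\<delta> n\<close>, and \<open>\<delta> n \<le> \<delta> N\<close> since \<open>q n < p\<close>
  forces \<open>n < N\<close> (lemmas \<open>variation_sum_lower_exponent\<close> and \<open>card_nonoverlapping_le\<close>).
\<close>

text \<open>
  Compare Lebesgue measures: the interiors are disjoint subsets of \<open>[0,1]\<close>, and each contains the
  open interval between the end points, which already has the full length.
\<close>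

lemma sum_len_nonoverlapping_le_1:
  assumes "nonoverlapping s I"
  shows "(\<Sum>j<s. len (I j)) \<le> 1"
proof -
  define J where "J j = {Inf (I j)<..<Sup (I j)}" for j
  have I: "is_interval (I j)" "I j \<noteq> {}" "I j \<subseteq> {0..1}" if "j < s" for j
    using assms that by (auto simp: nonoverlapping_def)
  have bdd: "bdd_below (I j)" "bdd_above (I j)" if "j < s" for j
    using I(3)[OF that] by (auto intro: bdd_below_mono bdd_above_mono)
  have J_sub: "J j \<subseteq> I j" if "j < s" for j
  proof
    fix x assume "x \<in> J j"
    then obtain a b where "a \<in> I j" "a < x" "b \<in> I j" "x < b"
      using I(2)[OF \<open>j < s\<close>] bdd[OF \<open>j < s\<close>] unfolding J_def
      by (auto simp: cInf_less_iff less_cSup_iff)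
    then show "x \<in> I j"
      using I(1)[OF that] by (meson is_interval_1 less_imp_le)
  qed
  have "J j \<subseteq> interior (I j)" if "j < s" for j
    using J_sub[OF that] by (simp add: J_def interior_maximal)
  then have disj: "disjoint_family_on J {..<s}"
    using assms unfolding nonoverlapping_def disjoint_family_on_def by blast
  have "measure lborel (J j) = len (I j)" if "j < s" for j
    using I(2)[OF that] bdd[OF that] by (simp add: J_def len_def cInf_le_cSup)
  then have "(\<Sum>j<s. len (I j)) = (\<Sum>j<s. measure lborel (J j))"
    by simp
  also have "\<dots> = measure lborel (\<Union>j<s. J j)"
  proof (rule measure_finite_Union[symmetric])
    show "emeasure lborel (J j) \<noteq> \<infinity>" if "j \<in> {..<s}" for j
      using I(2)[of j] bdd[of j] that by (simp add: J_def cInf_le_cSup)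
    show "disjoint_family_on J {..<s}"
      by (rule disj)
  qed (auto simp: J_def)
  also have "\<dots> \<le> measure lborel {0..1::real}"
  proof (rule measure_mono_fmeasurable)
    show "(\<Union>j<s. J j) \<subseteq> {0..1}"
      using J_sub I(3) by blast
  qed (auto simp: J_def fmeasurable_def)
  finally show ?thesis by simp
qed

lemma card_nonoverlapping_le:
  assumes "nonoverlapping s I" and "0 < d" and "\<And>j. j < s \<Longrightarrow> 1 / d \<le> len (I j)"
  shows "real s \<le> d"
proof -
  have "real s * (1 / d) \<le> (\<Sum>j<s. len (I j))"
    using sum_bounded_below[of "{..<s}" "1 / d" "\<lambda>j. len (I j)"] assms(3) by simp
  also have "\<dots> \<le> 1"
    by (rule sum_len_nonoverlapping_le_1[OF assms(1)])
  finally show ?thesis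
    using assms(2) by (simp add: field_simps)
qed

lemma waterman_shiba_bounded:
  assumes "f \<in> waterman_shiba \<Lambda> p"
  obtains M where "\<And>s I. nonoverlapping s I \<Longrightarrow> variation_sum \<Lambda> p f s I \<le> M"
proof -
  obtain m :: nat where m: "(SUP (s, I) \<in> {(s, I). nonoverlapping s I}.
      ereal (variation_sum \<Lambda> p f s I)) < ereal (real m)"
    using assms unfolding waterman_shiba_def
    by (auto simp: less_PInf_Ex_of_nat)
  have "variation_sum \<Lambda> p f s I \<le> real m" if "nonoverlapping s I" for s I
  proof -
    have "ereal (variation_sum \<Lambda> p f s I)
        \<le> (SUP (s, I) \<in> {(s, I). nonoverlapping s I}. ereal (variation_sum \<Lambda> p f s I))"
      by (rule SUP_upper2[of "(s, I)"]) (use that in auto)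
    then show ?thesis
      using m by (meson ereal_less_eq(3) less_imp_le order_trans)
  qed
  then show ?thesis by (rule that)
qed

text \<open>
  A single interval is a nonoverlapping family, so \<open>x powr p / \<Lambda> 0 \<le> M\<close> for every increment \<open>x\<close>;
  the summand \<open>1\<close> accounts for the case \<open>x < 1\<close>, where \<open>x \<le> x powr p\<close> may fail.
\<close>

lemma increment_le:
  assumes "0 < \<Lambda> 0" and "1 \<le> p"
    and M: "\<And>s I. nonoverlapping s I \<Longrightarrow> variation_sum \<Lambda> p f s I \<le> M"
    and "nonoverlapping s I" and "j < s"
  shows "\<bar>increment f (I j)\<bar> \<le> 1 + M * \<Lambda> 0"
proof -
  let ?x = "\<bar>increment f (I j)\<bar>"
  have "nonoverlapping 1 (\<lambda>_. I j)"
    using assms(4,5) by (auto simp: nonoverlapping_def disjoint_family_on_def)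
  from M[OF this] have x: "?x powr p \<le> M * \<Lambda> 0"
    using assms(1) by (simp add: variation_sum_def field_simps)
  show ?thesis
  proof (cases "?x \<le> 1")
    case True
    then show ?thesis using x powr_ge_zero[of ?x p] by linarith
  next
    case False
    then have "?x powr 1 \<le> ?x powr p"
      using assms(2) by (intro powr_mono) auto
    with False x show ?thesis by simp
  qed
qed

lemma powr_le_one_plus_powr:
  fixes x :: real
  assumes "0 \<le> x" and "0 \<le> r" and "r \<le> p"
  shows "x powr r \<le> 1 + x powr p"
proof (cases "x \<le> 1")
  case True
  then have "x powr r \<le> 1"
    using assms by (simp add: powr_le1)
  then show ?thesis using powr_ge_zero[of x p] by linarith
next
  case False
  then have "x powr r \<le> x powr p"
    using assms by (intro powr_mono) auto
  then show ?thesis by linarith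
qed

lemma powr_le_powr_mult_powr:
  fixes x :: real
  assumes "0 \<le> x" and "x \<le> B" and "1 \<le> B" and "0 \<le> p" and "p \<le> r"
  shows "x powr r \<le> B powr r * x powr p"
proof -
  have "x powr r = x powr (r - p) * x powr p"
    by (simp flip: powr_add)
  also have "x powr (r - p) \<le> B powr (r - p)"
    using assms by (intro powr_mono2) auto
  also have "B powr (r - p) \<le> B powr r"
    using assms by (intro powr_mono) auto
  finally show ?thesis
    by (simp add: mult_right_mono)
qed

lemma powr_inverse_le_max_1:
  fixes K :: real
  assumes "0 \<le> x" and "x \<le> K" and "1 \<le> r"
  shows "x powr (1 / r) \<le> max 1 K"
proof -
  have "x powr (1 / r) \<le> max 1 K powr (1 / r)"
    using assms by (intro powr_mono2) auto
  also have "\<dots> \<le> max 1 K powr 1"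
    using assms by (intro powr_mono) auto
  finally show ?thesis by simp
qed

lemma variation_sum_nonneg:
  assumes "\<And>j. 0 < \<Lambda> j"
  shows "0 \<le> variation_sum \<Lambda> p f s I"
  unfolding variation_sum_def using assms by (intro sum_nonneg) (auto simp: less_imp_le)

text \<open>
  The constant \<open>1\<close> in \<open>x powr r \<le> 1 + x powr p\<close> is weighted by \<open>1 / \<Lambda> j\<close>; since \<open>\<Lambda>\<close> is
  increasing, no weight exceeds \<open>1 / \<Lambda> 0\<close>.
\<close>

lemma variation_sum_lower_exponent:
  assumes "\<And>j. 0 < \<Lambda> j" and "incseq \<Lambda>" and "0 \<le> r" and "r \<le> p"
  shows "variation_sum \<Lambda> r f s I \<le> real s / \<Lambda> 0 + variation_sum \<Lambda> p f s I"
proof -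
  let ?x = "\<lambda>j. \<bar>increment f (I j)\<bar>"
  have "?x j powr r / \<Lambda> j \<le> 1 / \<Lambda> 0 + ?x j powr p / \<Lambda> j" for j
  proof -
    have "?x j powr r / \<Lambda> j \<le> (1 + ?x j powr p) / \<Lambda> j"
      using assms by (intro divide_right_mono powr_le_one_plus_powr) (auto simp: less_imp_le)
    also have "\<dots> = 1 / \<Lambda> j + ?x j powr p / \<Lambda> j"
      by (simp add: add_divide_distrib)
    also have "1 / \<Lambda> j \<le> 1 / \<Lambda> 0"
      using assms by (intro divide_left_mono) (auto simp: incseq_def)
    finally show ?thesis by simp
  qed
  then have "variation_sum \<Lambda> r f s I \<le> (\<Sum>j<s. 1 / \<Lambda> 0 + ?x j powr p / \<Lambda> j)"
    unfolding variation_sum_def by (intro sum_mono)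
  then show ?thesis
    by (simp add: sum.distrib variation_sum_def)
qed

lemma variation_sum_raise_exponent:
  assumes "\<And>j. 0 < \<Lambda> j" and "1 \<le> B" and "0 \<le> p" and "p \<le> r"
    and "\<And>j. j < s \<Longrightarrow> \<bar>increment f (I j)\<bar> \<le> B"
  shows "variation_sum \<Lambda> r f s I \<le> B powr r * variation_sum \<Lambda> p f s I"
  unfolding variation_sum_def sum_distrib_left times_divide_eq_right
  using assms
  by (intro sum_mono divide_right_mono powr_le_powr_mult_powr) (auto simp: less_imp_le)

theorem corollary1p7:
  fixes \<Lambda> q \<delta> :: "nat \<Rightarrow> real" and Q :: ereal
  assumes "waterman \<Lambda>"
    and "1 < Q"
    and "\<And>n. 1 \<le> q n" and "incseq q" and "(\<lambda>n. ereal (q n)) \<longlonglongrightarrow> Q"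
    and "\<And>n. 2 \<le> \<delta> n" and "incseq \<delta>" and "filterlim \<delta> at_top sequentially"
  shows "(\<Union>p \<in> {p::real. 1 \<le> p \<and> ereal p < Q}. waterman_shiba \<Lambda> p) \<subseteq> LBV_seq \<Lambda> \<delta> q"
proof
  fix f assume "f \<in> (\<Union>p \<in> {p::real. 1 \<le> p \<and> ereal p < Q}. waterman_shiba \<Lambda> p)"
  then obtain p where p: "1 \<le> p" "ereal p < Q" and f: "f \<in> waterman_shiba \<Lambda> p"
    by auto
  have pos: "\<And>j. 0 < \<Lambda> j" and mono: "incseq \<Lambda>"
    using assms(1) by (auto simp: waterman_def)
  obtain M where M: "\<And>s I. nonoverlapping s I \<Longrightarrow> variation_sum \<Lambda> p f s I \<le> M"
    using waterman_shiba_bounded[OF f] by blast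
  have "nonoverlapping 0 (\<lambda>_. {})"
    by (simp add: nonoverlapping_def disjoint_family_on_def)
  from M[OF this] have M0: "0 \<le> M"
    by (simp add: variation_sum_def)
  obtain N where N: "\<And>n. N \<le> n \<Longrightarrow> p \<le> q n"
    using order_tendstoD(1)[OF assms(5) p(2)]
    unfolding eventually_sequentially by (metis less_ereal.simps(1) less_imp_le)
  define B where "B = 1 + M * \<Lambda> 0"
  have B: "1 \<le> B"
    using M0 pos[of 0] by (simp add: B_def)
  define K where "K = \<delta> N / \<Lambda> 0 + M"
  define C where "C = max (max 1 K) (B * max 1 M)"
  have bound: "variation_sum \<Lambda> (q n) f s I powr (1 / q n) \<le> C"
    if I: "nonoverlapping s I" and len: "\<forall>j<s. len (I j) \<ge> 1 / \<delta> n" for n s I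
  proof (cases "p \<le> q n")
    case True
    have q: "1 \<le> q n" by (rule assms(3))
    have "variation_sum \<Lambda> (q n) f s I \<le> B powr q n * variation_sum \<Lambda> p f s I"
      using True p(1) increment_le[OF pos p(1) M I]
      by (intro variation_sum_raise_exponent pos B) (auto simp: B_def)
    then have "variation_sum \<Lambda> (q n) f s I powr (1 / q n)
        \<le> (B powr q n * variation_sum \<Lambda> p f s I) powr (1 / q n)"
      using q by (intro powr_mono2 variation_sum_nonneg pos) auto
    also have "\<dots> = B * variation_sum \<Lambda> p f s I powr (1 / q n)"
      using q B by (simp add: powr_mult powr_powr)
    also have "\<dots> \<le> B * max 1 M"
      using B M[OF I] q
      by (intro mult_left_mono powr_inverse_le_max_1 variation_sum_nonneg pos) auto
    finally show ?thesis by (simp add: C_def)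
  next
    case False
    then have "n \<le> N"
      using N[of n] by linarith
    have "real s \<le> \<delta> n"
      using assms(6)[of n] len by (intro card_nonoverlapping_le[OF I]) auto
    also have "\<dots> \<le> \<delta> N"
      using \<open>n \<le> N\<close> assms(7) by (simp add: incseq_def)
    finally have s: "real s / \<Lambda> 0 \<le> \<delta> N / \<Lambda> 0"
      using pos[of 0] by (simp add: divide_right_mono)
    have "variation_sum \<Lambda> (q n) f s I \<le> real s / \<Lambda> 0 + variation_sum \<Lambda> p f s I"
      using False assms(3)[of n] by (intro variation_sum_lower_exponent pos mono) auto
    also have "\<dots> \<le> K"
      unfolding K_def by (intro add_mono s M[OF I])
    finally have "variation_sum \<Lambda> (q n) f s I powr (1 / q n) \<le> max 1 K"
      by (intro powr_inverse_le_max_1 variation_sum_nonneg pos assms(3))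
    then show ?thesis by (simp add: C_def)
  qed
  have "(SUP n. SUP (s, I) \<in> {(s, I). nonoverlapping s I \<and> (\<forall>j<s. len (I j) \<ge> 1 / \<delta> n)}.
      ereal (variation_sum \<Lambda> (q n) f s I powr (1 / q n))) \<le> ereal C"
    using bound by (auto intro!: SUP_least)
  also have "\<dots> < \<infinity>"
    by simp
  finally show "f \<in> LBV_seq \<Lambda> \<delta> q"
    by (simp add: LBV_seq_def)
qed

end
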